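(* $\min\{\mathfrak{d}, \mathfrak{r}\} \leq {\rm non}^{\ast}(\mathcal{Z}_0)$.
   Context: $\omega$ is the set of natural numbers. $\mathcal{Z}_0$ is the ideal of all $A\subseteq\omega$ of asymptotic density zero, i.e. $\lim_{n\to\infty}|A\cap n|/n=0$. ${\rm non}^{\ast}(\mathcal{Z}_0)$ is the least size of a family $\mathcal{F}$ of infinite subsets of $\omega$ such that for every $b\in\mathcal{Z}_0$ there is $a\in\mathcal{F}$ with $a\cap b$ finite. $\mathfrak{d}$ is the dominating number and $\mathfrak{r}$ the reaping number. *)

theory Defs
  imports Complex_Main
begin

unbundle cardinal_syntax

text \<open>The least cardinality of a family satisfying \<open>P\<close>. The choice only selects a family of least
  cardinality, so the value is determined up to \<open>=o\<close>; it is meaningful when some family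
  satisfies \<open>P\<close>.\<close>

definition least_size :: "('a set \<Rightarrow> bool) \<Rightarrow> 'a rel" where
  "least_size P = |SOME F. P F \<and> (\<forall>G. P G \<longrightarrow> |F| \<le>o |G| )|"

lemma least_size_attained:
  assumes "P F0"
  shows "\<exists>F. P F \<and> least_size P = |F| \<and> (\<forall>G. P G \<longrightarrow> |F| \<le>o |G| )"
proof -
  let ?R = "{|F| |F. P F}"
  have "?R \<noteq> {}" "\<forall>r\<in>?R. Card_order r"
    using assms card_of_Card_order by auto
  from exists_minim_Card_order[OF this]
  have "\<exists>F. P F \<and> (\<forall>G. P G \<longrightarrow> |F| \<le>o |G| )"
    by blast
  from someI_ex[OF this] show ?thesis
    unfolding least_size_def by blast
qed

text \<open>The minimum of two cardinals whose underlying types may differ, realised on the sum type.\<close>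

definition card_min :: "'a rel \<Rightarrow> 'b rel \<Rightarrow> ('a + 'b) rel" where
  "card_min r s = (if r \<le>o s then |Inl ` Field r| else |Inr ` Field s| )"

lemma card_of_inj_image_Field:
  assumes "inj f" "Card_order r"
  shows "|f ` Field r| =o r"
proof -
  have "bij_betw f (Field r) (f ` Field r)"
    using assms(1) by (simp add: bij_betw_def inj_on_def)
  then have "|Field r| =o |f ` Field r|"
    using card_of_ordIso by blast
  then show ?thesis
    using card_of_Field_ordIso[OF assms(2)] ordIso_symmetric ordIso_transitive by blast
qed

lemma card_min_ordIso:
  assumes "Card_order r" "Card_order s"
  shows "r \<le>o s \<Longrightarrow> card_min r s =o r" "s \<le>o r \<Longrightarrow> card_min r s =o s"
proof -
  show 1: "card_min r s =o r" if "r \<le>o s"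
    using that card_of_inj_image_Field[OF inj_Inl assms(1)] by (simp add: card_min_def)
  show "card_min r s =o s" if "s \<le>o r"
  proof (cases "r \<le>o s")
    case True
    then show ?thesis
      using 1[OF True] that ordIso_iff_ordLeq[of r s] ordIso_transitive[of "card_min r s" r s]
      by blast
  next
    case False
    then show ?thesis using card_of_inj_image_Field[OF inj_Inr assms(2)] by (simp add: card_min_def)
  qed
qed

definition dominating :: "(nat \<Rightarrow> nat) set \<Rightarrow> bool" where
  "dominating D \<longleftrightarrow> (\<forall>f. \<exists>g\<in>D. \<forall>\<^sub>F n in sequentially. f n \<le> g n)"

definition dominating_number :: "(nat \<Rightarrow> nat) rel" ("\<dd>") where
  "\<dd> = least_size dominating"

definition splits :: "nat set \<Rightarrow> nat set \<Rightarrow> bool" where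
  "splits X A \<longleftrightarrow> infinite (A \<inter> X) \<and> infinite (A - X)"

definition reaping :: "nat set set \<Rightarrow> bool" where
  "reaping R \<longleftrightarrow> (\<forall>A\<in>R. infinite A) \<and> (\<nexists>X. \<forall>A\<in>R. splits X A)"

definition reaping_number :: "nat set rel" ("\<rr>") where
  "\<rr> = least_size reaping"

definition density_zero :: "nat set set" ("\<Z>\<^sub>0") where
  "\<Z>\<^sub>0 = {A. (\<lambda>n. real (card (A \<inter> {..<n})) / real n) \<longlonglongrightarrow> 0}"

definition non_star_family :: "nat set set \<Rightarrow> nat set set \<Rightarrow> bool" where
  "non_star_family I F \<longleftrightarrow> (\<forall>a\<in>F. infinite a) \<and> (\<forall>b\<in>I. \<exists>a\<in>F. finite (a \<inter> b))"

definition non_star :: "nat set set \<Rightarrow> nat set rel" ("non\<^sup>*") where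
  "non\<^sup>* I = least_size (non_star_family I)"

text \<open>The three numbers are well defined: families of the required kind exist.\<close>

lemma dominating_UNIV: "dominating UNIV"
  unfolding dominating_def by (intro allI) (rule bexI, rule always_eventually, auto)

lemma reaping_all_infinite: "reaping {A. infinite A}"
proof -
  have "\<exists>A. infinite A \<and> \<not> splits X A" for X
  proof -
    have "\<not> splits X UNIV" if "finite X" using that by (simp add: splits_def)
    moreover have "\<not> splits X X" by (simp add: splits_def)
    ultimately show ?thesis using infinite_UNIV_nat by blast
  qed
  then show ?thesis unfolding reaping_def by blast
qed

lemma density_zero_coinfinite:
  assumes "b \<in> \<Z>\<^sub>0"
  shows "infinite (- b)"
proof
  assume "finite (- b)"
  then obtain m where m: "\<forall>n\<in>- b. n < m"
    using finite_nat_set_iff_bounded by blast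
  have ev: "\<forall>\<^sub>F n in sequentially. 1 / 2 \<le> real (card (b \<inter> {..<n})) / real n"
    using eventually_ge_at_top[of "2 * m + 1"]
  proof eventually_elim
    case (elim n)
    have "{m..<n} \<subseteq> b \<inter> {..<n}"
    proof
      fix k assume k: "k \<in> {m..<n}"
      then have "k \<notin> - b" using m by (metis atLeastLessThan_iff leD)
      then show "k \<in> b \<inter> {..<n}" using k by simp
    qed
    then have "n - m \<le> card (b \<inter> {..<n})"
      using card_mono[of "b \<inter> {..<n}" "{m..<n}"] by simp
    then have "real n \<le> 2 * real (card (b \<inter> {..<n}))"
      using elim by linarith
    then show ?case using elim by (simp add: field_simps)
  qed
  have "1 / 2 \<le> (0 :: real)"
    using tendsto_lowerbound[OF _ ev sequentially_bot] assms
    unfolding density_zero_def by blast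
  then show False by simp
qed

lemma non_star_family_density_zero: "non_star_family \<Z>\<^sub>0 {A. infinite A}"
  unfolding non_star_family_def
proof (intro conjI ballI)
  fix b assume "b \<in> \<Z>\<^sub>0"
  then have "- b \<in> {A. infinite A}" "finite (- b \<inter> b)"
    using density_zero_coinfinite by auto
  then show "\<exists>a\<in>{A. infinite A}. finite (a \<inter> b)" by blast
qed simp

end

theory Submission
  imports Defs "HOL-Library.Discrete_Functions"
    "HOL-Library.Infinite_Set"
begin

text \<open>
  Let \<open>F\<close> be a family of infinite sets with fewer than \<open>\<dd>\<close> and fewer than \<open>\<rr>\<close> members.
  Cut \<open>\<omega>\<close> into the dyadic blocks \<open>[2^j, 2^(j+1))\<close>. Since \<open>F\<close> is not reaping, there is a set \<open>X\<close>
  such that, letting \<open>j \<in> X\<close> predict the last binary digit of the numbers in block \<open>j\<close>, every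
  member of \<open>F\<close> contains infinitely many numbers predicted correctly. Restricting to these numbers
  and iterating over the digits gives decreasing sets \<open>S\<^sub>n\<close> that meet every member of \<open>F\<close> in an
  infinite set and whose elements in one block all agree modulo \<open>2^n\<close>, so that \<open>S\<^sub>n\<close> has upper
  density at most \<open>2^(-n)\<close>. As \<open>F\<close> has fewer than \<open>\<dd>\<close> members, some pseudo-intersection of the
  \<open>S\<^sub>n\<close> still meets every member of \<open>F\<close> in an infinite set, and it has density zero.
\<close>

lemma card_min_ordLeq:
  assumes "Card_order r" "Card_order s" "r \<le>o t \<or> s \<le>o t"
  shows "card_min r s \<le>o t"
proof -
  consider "r \<le>o s" | "s \<le>o r"
    using ordLeq_total[OF card_order_on_well_order_on card_order_on_well_order_on, OF assms(1,2)]
    by (elim disjE)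
  then show ?thesis
  proof cases
    case 1
    then have "r \<le>o t"
      using assms(3) ordLeq_transitive[OF 1] by (elim disjE)
    then show ?thesis
      by (rule ordIso_ordLeq_trans[OF card_min_ordIso(1)[OF assms(1,2) 1]])
  next
    case 2
    then have "s \<le>o t"
      using assms(3) ordLeq_transitive[OF 2] by (elim disjE)
    then show ?thesis
      by (rule ordIso_ordLeq_trans[OF card_min_ordIso(2)[OF assms(1,2) 2]])
  qed
qed

lemma least_size_ordLeq: "P G \<Longrightarrow> least_size P \<le>o |G|"
  using least_size_attained[of P G] by auto

lemma Card_order_least_size: "Card_order (least_size P)"
  unfolding least_size_def by (rule card_of_Card_order)

lemma not_dominating_image:
  assumes "\<not> \<dd> \<le>o |F|"
  shows "\<not> dominating (g ` F)"
  using assms least_size_ordLeq[of dominating "g ` F"] card_of_image[of g F]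
    ordLeq_transitive unfolding dominating_number_def by blast

lemma not_reaping_image:
  assumes "\<not> \<rr> \<le>o |F|"
  shows "\<not> reaping (g ` F)"
  using assms least_size_ordLeq[of reaping "g ` F"] card_of_image[of g F]
    ordLeq_transitive unfolding reaping_number_def by blast

lemma infinite_image_finite_to_one:
  assumes "infinite A" "\<And>j. finite (J -` {j})"
  shows "infinite (J ` A)"
proof
  assume "finite (J ` A)"
  then have "finite (\<Union>j\<in>J ` A. J -` {j})"
    using assms(2) by (rule finite_UN_I)
  moreover have "A \<subseteq> (\<Union>j\<in>J ` A. J -` {j})"
    by auto
  ultimately show False
    using assms(1) finite_subset by blast
qed

text \<open>For each \<open>a\<close>, the predicate \<open>p\<close> takes some truth value
  \<open>c a\<close> infinitely often on \<open>a \<inter> S\<close>. The \<open>J\<close>-images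
  \<open>B a\<close> of these places are infinite because \<open>J\<close> is finite-to-one, so a
  single \<open>X\<close> splits all of them. Splitting supplies infinitely many values in
  \<open>X\<close> and infinitely many outside it, so the prediction is right infinitely often
  whichever value \<open>c a\<close> is.\<close>

lemma predict_infinitely_often:
  fixes J :: "nat \<Rightarrow> nat"
  assumes F: "\<not> \<rr> \<le>o |F|" and inf: "\<And>a. a \<in> F \<Longrightarrow> infinite (a \<inter> S)"
    and J: "\<And>j. finite (J -` {j})"
  shows "\<exists>X. \<forall>a\<in>F. infinite (a \<inter> (S \<inter> {x. p x \<longleftrightarrow> J x \<in> X}))"
proof -
  have "\<exists>c. infinite (a \<inter> S \<inter> {x. p x \<longleftrightarrow> c})" if "a \<in> F" for a
  proof (rule ccontr)
    assume "\<not> ?thesis"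
    then have "finite (a \<inter> S \<inter> {x. p x \<longleftrightarrow> True})" "finite (a \<inter> S \<inter> {x. p x \<longleftrightarrow> False})"
      by blast+
    moreover have "a \<inter> S = (a \<inter> S \<inter> {x. p x \<longleftrightarrow> True}) \<union> (a \<inter> S \<inter> {x. p x \<longleftrightarrow> False})"
      by auto
    ultimately show False
      using inf[OF that] by (metis finite_UnI)
  qed
  then obtain c where c: "\<And>a. a \<in> F \<Longrightarrow> infinite (a \<inter> S \<inter> {x. p x \<longleftrightarrow> c a})"
    by metis
  define B where "B a = J ` (a \<inter> S \<inter> {x. p x \<longleftrightarrow> c a})" for a
  have "\<forall>A\<in>B ` F. infinite A"
    using infinite_image_finite_to_one[OF c J] unfolding B_def by blast
  then obtain X where X: "\<And>a. a \<in> F \<Longrightarrow> splits X (B a)"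
    using not_reaping_image[OF F, of B] unfolding reaping_def by blast
  have "infinite (a \<inter> (S \<inter> {x. p x \<longleftrightarrow> J x \<in> X}))" (is "infinite ?A") if a: "a \<in> F" for a
  proof
    assume "finite ?A"
    then have fin: "finite (J ` ?A)"
      by simp
    have "(if c a then B a \<inter> X else B a - X) \<subseteq> J ` ?A"
      unfolding B_def by auto
    then show False
      using X[OF a] finite_subset[OF _ fin] unfolding splits_def by (auto split: if_splits)
  qed
  then show ?thesis by blast
qed

text \<open>If \<open>g a n\<close> is an element of \<open>a \<inter> S n\<close> beyond
  \<open>n\<close>, too few functions \<open>g a\<close> arise to dominate, so some \<open>f\<close>
  exceeds each of them infinitely often. Such an \<open>f\<close> tells how long an initial segment
  may be added to each \<open>S n\<close> so that the intersection still catches infinitely many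
  \<open>g a n\<close>.\<close>

lemma pseudo_intersection_meeting:
  fixes S :: "nat \<Rightarrow> nat set"
  assumes F: "\<not> \<dd> \<le>o |F|" and inf: "\<And>a n. a \<in> F \<Longrightarrow> infinite (a \<inter> S n)" and S: "decseq S"
  shows "\<exists>b. (\<forall>n. finite (b - S n)) \<and> (\<forall>a\<in>F. infinite (a \<inter> b))"
proof -
  have "\<exists>g. \<forall>n. n < g n \<and> g n \<in> a \<inter> S n" if "a \<in> F" for a
    using inf[OF that] unfolding infinite_nat_iff_unbounded by (intro choice) blast
  then obtain g where g: "\<And>a n. a \<in> F \<Longrightarrow> n < g a n \<and> g a n \<in> a \<inter> S n"
    by metis
  obtain f where f: "\<And>a. a \<in> F \<Longrightarrow> \<not> (\<forall>\<^sub>F n in sequentially. f n \<le> g a n)"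
    using not_dominating_image[OF F, of g] unfolding dominating_def by blast
  \<comment> \<open>Partial sums replace \<open>f\<close> by a monotone function above it, so that
    \<open>g a n < f n\<close> also bounds \<open>g a n\<close> by every later
    \<open>h i\<close>.\<close>
  define h where "h n = (\<Sum>i\<le>n. f i)" for n
  have h_mono: "h m \<le> h n" if "m \<le> n" for m n
    using that unfolding h_def by (intro sum_mono2) auto
  have f_le_h: "f n \<le> h n" for n
    unfolding h_def by (rule member_le_sum) auto
  define b where "b = (\<Inter>n. S n \<union> {..h n})"
  have "finite (b - S n)" for n
    by (rule finite_subset[of _ "{..h n}"]) (auto simp: b_def)
  moreover have "infinite (a \<inter> b)" if a: "a \<in> F" for a
    unfolding infinite_nat_iff_unbounded
  proof
    fix m
    obtain n where n: "m \<le> n" "g a n < f n"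
      using f[OF a] unfolding eventually_sequentially by (meson not_le)
    \<comment> \<open>The sets up to stage \<open>n\<close> contain \<open>g a n\<close> because
      \<open>S\<close> decreases; the later ones are covered by their initial segments.\<close>
    have "g a n \<in> S i \<union> {..h i}" for i
    proof (cases "i \<le> n")
      case True
      then show ?thesis using g[OF a, of n] decseqD[OF S True] by blast
    next
      case False
      then have "g a n \<le> h i"
        using n(2) f_le_h[of n] h_mono[of n i] by simp
      then show ?thesis by simp
    qed
    then have "g a n \<in> a \<inter> b"
      using g[OF a, of n] unfolding b_def by blast
    then show "\<exists>x>m. x \<in> a \<inter> b"
      using g[OF a, of n] n(1) by (meson le_less_trans)
  qed
  ultimately show ?thesis by blast
qed

lemma finite_floor_log_vimage: "finite (floor_log -` {j})"
proof (rule finite_subset)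
  \<comment> \<open>Since \<open>floor_log 0 = 0\<close>, the number 0 belongs to block 0 together
    with 1.\<close>
  show "floor_log -` {j} \<subseteq> {..2 * 2 ^ j}"
  proof
    fix x assume "x \<in> floor_log -` {j}"
    then show "x \<in> {..2 * 2 ^ j}"
      using floor_log_exp2_gt[of x] by simp
  qed
qed simp

text \<open>This makes the dyadic block of \<open>x\<close> a function of
  \<open>x div 2 ^ n\<close>. The hypothesis keeps the quotient positive.\<close>

lemma floor_log_div_power:
  assumes "2 ^ n \<le> x"
  shows "floor_log x = floor_log (x div 2 ^ n) + n"
  using assms
proof (induction n arbitrary: x)
  case (Suc n)
  then have "2 \<le> x" and "2 ^ n \<le> x div 2"
    using one_le_power[of "2::nat" n] by (simp_all only: power_Suc) linarith+
  then show ?case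
    using floor_log_rec[of x] Suc.IH[of "x div 2"] by (simp add: div_mult2_eq)
qed simp

lemma card_less_le_of_inj_div:
  fixes S :: "nat set"
  assumes "inj_on (\<lambda>x. x div q) (S \<inter> {q..})"
  shows "card (S \<inter> {..<N}) \<le> q + (N div q + 1)"
proof -
  have "card (S \<inter> {q..} \<inter> {..<N}) \<le> card {..N div q}"
    by (rule card_inj_on_le[where f = "\<lambda>x. x div q"])
      (auto intro: inj_on_subset[OF assms] div_le_mono)
  moreover have "card (S \<inter> {..<N}) \<le> card ({..<q} \<union> (S \<inter> {q..} \<inter> {..<N}))"
    by (rule card_mono) auto
  ultimately show ?thesis
    using card_Un_le[of "{..<q}" "S \<inter> {q..} \<inter> {..<N}"] by simp
qed

text \<open>Beyond \<open>2 ^ n\<close>, each interval of length \<open>2 ^ n\<close> given by one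
  quotient holds at most one element of \<open>S n\<close>. Hence \<open>b\<close>, almost contained
  in every \<open>S n\<close>, has upper density at most \<open>2 ^ (-n)\<close> for every
  \<open>n\<close>.\<close>

lemma density_zero_if_inj_div:
  assumes fin: "\<And>n. finite (b - S n)"
    and inj: "\<And>n. inj_on (\<lambda>x. x div 2 ^ n) (S n \<inter> {2 ^ n..})"
  shows "b \<in> \<Z>\<^sub>0"
proof -
  have "(\<lambda>N. real (card (b \<inter> {..<N})) / real N) \<longlonglongrightarrow> 0"
  proof (rule LIMSEQ_I)
    fix e :: real assume e: "0 < e"
    obtain n where n: "(1 / 2) ^ n < e / 2"
      using real_arch_pow_inv[of "e / 2" "1 / 2"] e by auto
    \<comment> \<open>\<open>K\<close> collects the errors independent of \<open>N\<close>: the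
      points of \<open>b\<close> outside \<open>S n\<close>, the numbers below \<open>2 ^ n\<close>,
      and 1 for the quotient 0. From \<open>M\<close> on they cost less than half of
      \<open>e * N\<close>.\<close>
    define K where "K = card (b - S n) + 2 ^ n + 1"
    obtain M :: nat where M: "real K / (e / 2) < real M"
      using reals_Archimedean2 by blast
    have "norm (real (card (b \<inter> {..<N})) / real N - 0) < e" if N: "M \<le> N" for N
    proof -
      have "real K / (e / 2) < real N"
        using M N by linarith
      then have K: "real K < e / 2 * real N"
        using e by (simp add: divide_less_eq mult.commute)
      then have N0: "0 < real N"
        using e by (cases "N = 0") simp_all
      have "card (b \<inter> {..<N}) \<le> card ((b - S n) \<union> (S n \<inter> {..<N}))"
        by (rule card_mono) (auto simp: fin)
      also have "\<dots> \<le> K + N div 2 ^ n"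
        using card_Un_le[of "b - S n" "S n \<inter> {..<N}"] card_less_le_of_inj_div[OF inj, of n N]
        unfolding K_def by linarith
      finally have "real (card (b \<inter> {..<N})) \<le> real K + real (N div 2 ^ n)"
        by linarith
      also have "\<dots> \<le> real K + (1 / 2) ^ n * real N"
        using of_nat_div_le_of_nat[of N "2 ^ n", where 'a = real]
        by (simp add: power_one_over field_simps)
      also have "\<dots> < e / 2 * real N + e / 2 * real N"
        using K mult_strict_right_mono[OF n N0] by linarith
      finally show ?thesis
        using N0 by (simp add: field_simps)
    qed
    then show "\<exists>M. \<forall>N\<ge>M. norm (real (card (b \<inter> {..<N})) / real N - 0) < e"
      by blast
  qed
  then show ?thesis unfolding density_zero_def by blast
qed

lemma density_zero_meeting:
  assumes d: "\<not> \<dd> \<le>o |F|" and r: "\<not> \<rr> \<le>o |F|" and inf: "\<And>a. a \<in> F \<Longrightarrow> infinite a"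
  shows "\<exists>b\<in>\<Z>\<^sub>0. \<forall>a\<in>F. infinite (a \<inter> b)"
proof -
  \<comment> \<open>Keeping the stage as a relation lets dependent choice deliver the shape of
    \<open>S (Suc n)\<close>, from which both monotonicity and the agreement of digits are read
    off.\<close>
  define Q where "Q n S T \<longleftrightarrow> (\<exists>X. T = S \<inter> {x. bit x n \<longleftrightarrow> floor_log x \<in> X})"
    for n and S T :: "nat set"
  have "\<exists>S. \<forall>n. (\<forall>a\<in>F. infinite (a \<inter> S n)) \<and> Q n (S n) (S (Suc n))"
  proof (rule dependent_nat_choice)
    show "\<exists>S. \<forall>a\<in>F. infinite (a \<inter> S)"
      using inf by (intro exI[of _ UNIV]) simp
  next
    fix S n assume "\<forall>a\<in>F. infinite (a \<inter> S)"
    then show "\<exists>T. (\<forall>a\<in>F. infinite (a \<inter> T)) \<and> Q n S T"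
      using predict_infinitely_often[OF r _ finite_floor_log_vimage, of S "\<lambda>x. bit x n"]
      unfolding Q_def by blast
  qed
  then obtain S where S: "\<And>a n. a \<in> F \<Longrightarrow> infinite (a \<inter> S n)"
    and Q: "\<And>n. Q n (S n) (S (Suc n))"
    by blast
  have dec: "decseq S"
    using Q unfolding decseq_Suc_iff Q_def by blast
  have mod_eq: "take_bit n x = take_bit n y"
    if "x \<in> S n" "y \<in> S n" "floor_log x = floor_log y" for x y n
    using that
  proof (induction n)
    case (Suc n)
    obtain X where X: "S (Suc n) = S n \<inter> {x. bit x n \<longleftrightarrow> floor_log x \<in> X}"
      using Q[of n] unfolding Q_def by blast
    \<comment> \<open>Numbers in one block receive the same prediction for digit \<open>n\<close>,
      and in \<open>S (Suc n)\<close> this prediction is correct for both.\<close>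
    have "x \<in> S n" "y \<in> S n" "bit x n \<longleftrightarrow> bit y n"
      using Suc.prems X by simp_all
    moreover have "take_bit n x = take_bit n y"
      using Suc.IH Suc.prems(3) calculation by blast
    ultimately show ?case
      by (simp only: take_bit_Suc_from_most)
  qed simp
  \<comment> \<open>From \<open>2 ^ n\<close> on, the quotient determines the block, and within a
    block of \<open>S n\<close> the remainder is constant.\<close>
  have inj: "inj_on (\<lambda>x. x div 2 ^ n) (S n \<inter> {2 ^ n..})" for n
  proof (rule inj_onI)
    fix x y
    assume x: "x \<in> S n \<inter> {2 ^ n..}" and y: "y \<in> S n \<inter> {2 ^ n..}"
      and eq: "x div 2 ^ n = y div 2 ^ n"
    have "floor_log x = floor_log y"
      using x y eq by (simp add: floor_log_div_power[of n])
    then have "x mod 2 ^ n = y mod 2 ^ n"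
      using mod_eq x y by (simp add: take_bit_eq_mod)
    then show "x = y"
      using eq by (metis div_mult_mod_eq)
  qed
  obtain b where "\<And>n. finite (b - S n)" "\<forall>a\<in>F. infinite (a \<inter> b)"
    using pseudo_intersection_meeting[OF d S dec] by blast
  then show ?thesis
    using density_zero_if_inj_div[OF _ inj] by blast
qed

theorem theorem3p15: "card_min \<dd> \<rr> \<le>o non\<^sup>* \<Z>\<^sub>0"
proof -
  obtain F where F: "non_star_family \<Z>\<^sub>0 F" "non\<^sup>* \<Z>\<^sub>0 = |F|"
    using least_size_attained[of "non_star_family \<Z>\<^sub>0", OF non_star_family_density_zero]
    unfolding non_star_def by blast
  then have "\<dd> \<le>o |F| \<or> \<rr> \<le>o |F|"
    using density_zero_meeting[of F] unfolding non_star_family_def by blast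
  then show ?thesis
    unfolding F(2) dominating_number_def reaping_number_def
    by (intro card_min_ordLeq Card_order_least_size)
qed

end
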